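(* Let $\mathbb{X}$ be a Euclidean space, let $D \subseteq \mathbb{X}$ be nonempty and closed, and let $\varphi : \mathbb{X} \to \mathbb{R}$ be upper-$\mathcal{C}^2$ on $\mathbb{X}$ with $\inf \varphi > -\infty$. Let $\{x^k\}$ be a sequence generated by the Nonmonotone Projected Subgradient Method (described in the context) given some $x^0 \in D$. Then either the method stops after a finite number of iterations at a point $x^k$ with $-w^k \in N^P_D(x^k)$, or the following assertions hold for $\{x^k\}$: 1. Any accumulation point $x^*$ of $\{x^k\}$ is a proximal critical point, that is, there exists $w^* \in \partial\varphi(x^* )$ such that $-w^* \in N^P_D(x^* )$. 2. Let $x^*$ be an accumulation point of $\{x^k\}$. Then the sequence $\{\varphi(x^k)\}$ converges to $\varphi(x^* )$, and the sequence $\{\mathcal{R}_k\}$ converges monotonically to $\varphi(x^* )$.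
   Context: $\mathbb{X}$ is a Euclidean space (finite-dimensional real Hilbert space) with inner product $\langle\cdot,\cdot\rangle$ and induced norm $\|\cdot\|$. For a nonempty closed set $D\subseteq\mathbb{X}$ (not necessarily convex), $\Pi_D(x) := \{y \in D : \|x-y\| = \inf_{z\in D}\|x-z\|\}$ is the (set-valued) projection. Upper-$\mathcal{C}^2$: a function $\varphi$ is upper-$\mathcal{C}^2$ on an open set $U\subseteq\mathbb{X}$ if each $\bar x\in U$ has a neighborhood $V$ on which $\varphi(x)=\min_{c\in C}\varphi_c(x)$, where the functions $\varphi_c$ are of class $C^2$ on $V$, $C$ is a compact set (in some topological space), and $\varphi_c$ together with its first- and second-order partial derivatives depends continuously on $(x,c)\in V\times C$. Such functions are locally Lipschitz on $U$. Subdifferentials: the regular (Fréchet) subdifferential is $\partial^F\varphi(x)=\{v : \liminf_{y\to x,\,y\neq x}\frac{\varphi(y)-\varphi(x)-\langle v,y-x\rangle}{\|y-x\|}\ge 0\}$; the limiting subdifferential is $\partial^M\varphi(x)=\{v : \exists\, x^k\to x,\ \varphi(x^k)\to\varphi(x),\ v^k\to v,\ v^k\in\partial^F\varphi(x^k)\ \forall k\}$; the Clarke subdifferential is $\partial^C\varphi(x)=\{v:\langle v,h\rangle\le\varphi^\circ(x;h)\ \forall h\in\mathbb{X}\}$ with $\varphi^\circ(x;h)=\limsup_{z\to x,\,t\to0^+}\frac{\varphi(z+th)-\varphi(z)}{t}$. The symbol $\partial\varphi$ means either $\partial^M\varphi$ or $\partial^C\varphi$ (the result holds for each of the two choices, used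 consistently). Proximal normal cone: $N^P_D(\bar x)=\{v\in\mathbb{X} : \exists\,\bar\tau>0,\ \bar x\in\Pi_D(\bar x+\bar\tau v)\}$ for $\bar x \in D$. Nonmonotone Projected Subgradient Method. Input: $x^0\in D$, $0<\tau_{\min}\le\tau_{\max}<\infty$, $\sigma,\beta\in(0,1)$, $p_{\min}\in(0,1]$. Set $\mathcal{R}_0:=\varphi(x^0)$. For $k=0,1,2,\dots$: choose any $w^k\in\partial\varphi(x^k)$; if the termination criterion holds, stop and return $x^k$ (the termination criterion may be any criterion that is satisfied only if $-w^k\in N^P_D(x^k)$). Otherwise choose $\tau_k\in[\tau_{\min},\tau_{\max}]$ and $y^k\in\Pi_D(x^k-\tau_kw^k)$; while $\varphi(y^k)>\mathcal{R}_k+\sigma\langle w^k,y^k-x^k\rangle$, replace $\tau_k$ by $\beta\tau_k$ and choose a new $y^k\in\Pi_D(x^k-\tau_kw^k)$. When this loop ends, set $x^{k+1}:=y^k$, choose $p_{k+1}\in[p_{\min},1]$ and set $\mathcal{R}_{k+1}:=(1-p_{k+1})\mathcal{R}_k+p_{k+1}\varphi(x^{k+1})$. *)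

theory Defs
  imports "HOL-Analysis.Analysis"
begin

definition proj_set :: "'a::euclidean_space set \<Rightarrow> 'a \<Rightarrow> 'a set" where
  "proj_set D x = {y \<in> D. norm (x - y) = (INF z\<in>D. norm (x - z))}"

definition proximal_normal_cone :: "'a::euclidean_space set \<Rightarrow> 'a \<Rightarrow> 'a set" where
  "proximal_normal_cone D x = {v. \<exists>\<tau>>0. x \<in> proj_set D (x + \<tau> *\<^sub>R v)}"

(* f is of class C^2 on the open set V with gradient g and Hessian H (as a linear map);
   the partial derivatives of f are g x \<bullet> i and H x i \<bullet> j for i, j in Basis. *)
definition C2_on ::
  "'a::euclidean_space set \<Rightarrow> ('a \<Rightarrow> real) \<Rightarrow> ('a \<Rightarrow> 'a) \<Rightarrow> ('a \<Rightarrow> 'a \<Rightarrow> 'a) \<Rightarrow> bool" where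
  "C2_on V f g H \<longleftrightarrow> open V \<and>
     (\<forall>x\<in>V. GDERIV f x :> g x \<and> (g has_derivative H x) (at x)) \<and>
     (\<forall>i\<in>Basis. continuous_on V (\<lambda>x. H x i))"

(* The index set C is a compact set in an arbitrary topological space carried by the type 'c.
   Since HOL cannot quantify over types inside a formula, 'c is a type argument; in a theorem
   that assumes upper_C2_on TYPE('c) U \<phi> it is a free type variable, so the assumption reads
   "for some index type". *)
definition upper_C2_on ::
  "'c itself \<Rightarrow> 'a::euclidean_space set \<Rightarrow> ('a \<Rightarrow> real) \<Rightarrow> bool" where
  "upper_C2_on _ U \<phi> \<longleftrightarrow>
     (\<forall>xbar\<in>U. \<exists>V (T :: 'c topology) C f g H.
        open V \<and> xbar \<in> V \<and> V \<subseteq> U \<and> compactin T C \<and>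
        (\<forall>x\<in>V. (\<exists>c\<in>C. \<phi> x = f c x) \<and> (\<forall>c\<in>C. \<phi> x \<le> f c x)) \<and>
        (\<forall>c\<in>C. C2_on V (f c) (g c) (H c)) \<and>
        (let VC = prod_topology (top_of_set V) (subtopology T C) in
           continuous_map VC euclideanreal (\<lambda>(x, c). f c x) \<and>
           (\<forall>i\<in>Basis. continuous_map VC euclideanreal (\<lambda>(x, c). g c x \<bullet> i)) \<and>
           (\<forall>i\<in>Basis. \<forall>j\<in>Basis. continuous_map VC euclideanreal (\<lambda>(x, c). H c x i \<bullet> j))))"

definition regular_subdifferential :: "('a::euclidean_space \<Rightarrow> real) \<Rightarrow> 'a \<Rightarrow> 'a set" where
  "regular_subdifferential \<phi> x =
     {v. Liminf (at x) (\<lambda>y. ereal ((\<phi> y - \<phi> x - v \<bullet> (y - x)) / norm (y - x))) \<ge> 0}"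

definition limiting_subdifferential :: "('a::euclidean_space \<Rightarrow> real) \<Rightarrow> 'a \<Rightarrow> 'a set" where
  "limiting_subdifferential \<phi> x =
     {v. \<exists>X V. X \<longlonglongrightarrow> x \<and> (\<lambda>k. \<phi> (X k)) \<longlonglongrightarrow> \<phi> x \<and> V \<longlonglongrightarrow> v \<and>
               (\<forall>k. V k \<in> regular_subdifferential \<phi> (X k))}"

definition clarke_derivative :: "('a::euclidean_space \<Rightarrow> real) \<Rightarrow> 'a \<Rightarrow> 'a \<Rightarrow> ereal" where
  "clarke_derivative \<phi> x h =
     Limsup (nhds x \<times>\<^sub>F at_right 0) (\<lambda>(z, t). ereal ((\<phi> (z + t *\<^sub>R h) - \<phi> z) / t))"

definition clarke_subdifferential :: "('a::euclidean_space \<Rightarrow> real) \<Rightarrow> 'a \<Rightarrow> 'a set" where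
  "clarke_subdifferential \<phi> x = {v. \<forall>h. ereal (v \<bullet> h) \<le> clarke_derivative \<phi> x h}"

definition accumulation_point :: "(nat \<Rightarrow> 'a::topological_space) \<Rightarrow> 'a \<Rightarrow> bool" where
  "accumulation_point x a \<longleftrightarrow> (\<exists>r :: nat \<Rightarrow> nat. strict_mono r \<and> (x \<circ> r) \<longlonglongrightarrow> a)"

(* The while loop at an iterate x with subgradient w and reference value R, started with step
   size \<tau>: Y i is the trial point for step size \<beta>^i * \<tau>, and n is the number of times the step
   size is reduced, with n = \<infinity> if the loop never ends. *)
definition backtracking_loop ::
  "('a::euclidean_space \<Rightarrow> real) \<Rightarrow> 'a set \<Rightarrow> real \<Rightarrow> real \<Rightarrow> real \<Rightarrow> 'a \<Rightarrow> 'a \<Rightarrow>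
   real \<Rightarrow> (nat \<Rightarrow> 'a) \<Rightarrow> enat \<Rightarrow> bool" where
  "backtracking_loop \<phi> D \<sigma> \<beta> R x w \<tau> Y n \<longleftrightarrow>
     (\<forall>i. enat i \<le> n \<longrightarrow> Y i \<in> proj_set D (x - (\<beta> ^ i * \<tau>) *\<^sub>R w)) \<and>
     (\<forall>i. enat i < n \<longrightarrow> \<phi> (Y i) > R + \<sigma> * (w \<bullet> (Y i - x))) \<and>
     (\<forall>i. n = enat i \<longrightarrow> \<phi> (Y i) \<le> R + \<sigma> * (w \<bullet> (Y i - x)))"

(* A complete execution, where S x is the set of admissible subgradients at x. N is the index of
   the last iteration entered (\<infinity> if there is none); the sequences are meaningful only up to N.
   stop k is the outcome of the termination test in iteration k, so the test may depend on the
   whole history. In iteration k, \<tau> k is the initial step size, Y k are the trial points and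
   n k the number of step size reductions. An execution has a last iteration only if the
   termination test succeeds there or its while loop runs forever. *)
definition NPSM_run ::
  "('a::euclidean_space \<Rightarrow> 'a set) \<Rightarrow> ('a \<Rightarrow> real) \<Rightarrow> 'a set \<Rightarrow>
   real \<Rightarrow> real \<Rightarrow> real \<Rightarrow> real \<Rightarrow> real \<Rightarrow> (nat \<Rightarrow> bool) \<Rightarrow> enat \<Rightarrow>
   (nat \<Rightarrow> 'a) \<Rightarrow> (nat \<Rightarrow> 'a) \<Rightarrow> (nat \<Rightarrow> real) \<Rightarrow> (nat \<Rightarrow> real) \<Rightarrow>
   (nat \<Rightarrow> real) \<Rightarrow> (nat \<Rightarrow> nat \<Rightarrow> 'a) \<Rightarrow> (nat \<Rightarrow> enat) \<Rightarrow> bool" where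
  "NPSM_run S \<phi> D \<tau>min \<tau>max \<sigma> \<beta> pmin stop N x w R p \<tau> Y n \<longleftrightarrow>
     x 0 \<in> D \<and> R 0 = \<phi> (x 0) \<and>
     (\<forall>k. enat k \<le> N \<longrightarrow> w k \<in> S (x k)) \<and>
     (\<forall>k. enat k \<le> N \<longrightarrow> \<not> stop k \<longrightarrow>
        \<tau> k \<in> {\<tau>min..\<tau>max} \<and> backtracking_loop \<phi> D \<sigma> \<beta> (R k) (x k) (w k) (\<tau> k) (Y k) (n k)) \<and>
     (\<forall>k. enat k < N \<longrightarrow>
        \<not> stop k \<and> (\<exists>m. n k = enat m \<and> x (Suc k) = Y k m) \<and>
        p (Suc k) \<in> {pmin..1} \<and>
        R (Suc k) = (1 - p (Suc k)) * R k + p (Suc k) * \<phi> (x (Suc k))) \<and>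
     (\<forall>k. N = enat k \<longrightarrow> stop k \<or> n k = \<infinity>)"

end

theory Submission
  imports Defs
begin

text \<open>By compactness of the index set, around every point \<open>\<phi>\<close> has a supergradient at each \<open>z\<close> with one
  common quadratic error constant \<open>\<kappa>\<close> (that of an active \<open>C\<^sup>2\<close> piece). Limiting and Clarke subgradients
  then satisfy the same inequality, so they are locally bounded and have a closed graph. Since a
  projection step satisfies \<open>\<parallel>y - x\<parallel>\<^sup>2 \<le> - 2 t \<langle>w, y - x\<rangle>\<close>, the quadratic error is absorbed as soon as
  \<open>2 \<kappa> t \<le> 1 - \<sigma>\<close>: the while loop ends, and near an accumulation point the accepted step sizes stay away
  from \<open>0\<close>. The reference values decrease by a multiple of \<open>\<parallel>x\<^sup>k\<^sup>+\<^sup>1 - x\<^sup>k\<parallel>\<^sup>2\<close>, so successive iterates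
  merge, and the projection inclusion passes to the limit along a subsequence on which subgradients
  and step sizes converge.\<close>

subsection \<open>Supergradients with quadratic error\<close>

text \<open>A proximal supergradient inequality, demanded on a fixed set \<open>S\<close> with a
  fixed \<open>\<kappa>\<close> rather than asymptotically at \<open>z\<close>. In this form it
  survives limits in \<open>z\<close> and \<open>v\<close>.\<close>

definition supergradient_on :: "'a::euclidean_space set \<Rightarrow> real \<Rightarrow> ('a \<Rightarrow> real) \<Rightarrow> 'a \<Rightarrow> 'a \<Rightarrow> bool"
  where "supergradient_on S \<kappa> \<phi> z v \<longleftrightarrow>
    (\<forall>y\<in>S. \<phi> y \<le> \<phi> z + v \<bullet> (y - z) + \<kappa> * (norm (y - z))\<^sup>2)"

text \<open>One triple \<open>S\<close>, \<open>\<kappa>\<close>, \<open>L\<close> serves all base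
  points. Only some supergradient is asked for at each point; the later lemmas transfer its
  inequality to every limiting or Clarke subgradient.\<close>

definition superdifferentiable_on :: "'a::euclidean_space set \<Rightarrow> real \<Rightarrow> real \<Rightarrow> ('a \<Rightarrow> real) \<Rightarrow> bool"
  where "superdifferentiable_on S \<kappa> L \<phi> \<longleftrightarrow>
    (\<forall>z\<in>S. \<exists>g. norm g \<le> L \<and> supergradient_on S \<kappa> \<phi> z g)"

lemma supergradient_onD:
  assumes "supergradient_on S \<kappa> \<phi> z v" "y \<in> S"
  shows "\<phi> y \<le> \<phi> z + v \<bullet> (y - z) + \<kappa> * (norm (y - z))\<^sup>2"
  using assms by (auto simp: supergradient_on_def)

lemma superdifferentiable_onD:
  assumes "superdifferentiable_on S \<kappa> L \<phi>" "z \<in> S"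
  shows "\<exists>g. norm g \<le> L \<and> supergradient_on S \<kappa> \<phi> z g"
  using assms by (auto simp: superdifferentiable_on_def)

lemma continuous_map_bounded_on_compactin_prod:
  assumes "continuous_map (prod_topology (top_of_set V) (subtopology T C)) euclideanreal F"
    and "compact K" "K \<subseteq> V" "compactin T C"
  shows "\<exists>B. \<forall>x\<in>K. \<forall>c\<in>C. \<bar>F (x, c)\<bar> \<le> B"
proof -
  have "compactin (prod_topology (top_of_set V) (subtopology T C)) (K \<times> C)"
    using assms(2-4) by (simp add: compactin_Times compactin_subtopology)
  then have "compact (F ` (K \<times> C))"
    using image_compactin[OF _ assms(1)] by simp
  then obtain B where "\<forall>y\<in>F ` (K \<times> C). norm y \<le> B"
    using compact_imp_bounded bounded_iff by metis
  then show ?thesis by (intro exI[of _ B]) auto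
qed

lemma uniform_bound_over_finite:
  fixes F :: "'i \<Rightarrow> 'x \<Rightarrow> 'c \<Rightarrow> real"
  assumes "finite I" "\<And>i. i \<in> I \<Longrightarrow> \<exists>B. \<forall>x\<in>K. \<forall>c\<in>C. \<bar>F i x c\<bar> \<le> B"
  shows "\<exists>B\<ge>0. \<forall>x\<in>K. \<forall>c\<in>C. (\<Sum>i\<in>I. \<bar>F i x c\<bar>) \<le> B"
proof -
  obtain B where B: "\<And>i x c. i \<in> I \<Longrightarrow> x \<in> K \<Longrightarrow> c \<in> C \<Longrightarrow> \<bar>F i x c\<bar> \<le> B i"
    using assms(2) by metis
  show ?thesis
  \<comment> \<open>The absolute value makes the bound nonnegative even if \<open>K\<close> or
    \<open>C\<close> is empty.\<close>
  proof (intro exI[of _ "\<bar>\<Sum>i\<in>I. B i\<bar>"] conjI ballI)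
    fix x c assume "x \<in> K" "c \<in> C"
    then have "(\<Sum>i\<in>I. \<bar>F i x c\<bar>) \<le> (\<Sum>i\<in>I. B i)"
      by (intro sum_mono B)
    then show "(\<Sum>i\<in>I. \<bar>F i x c\<bar>) \<le> \<bar>\<Sum>i\<in>I. B i\<bar>" by linarith
  qed simp
qed

text \<open>The mean value inequality is applied twice: the Hessian bound makes \<open>g\<close>
  Lipschitz with constant \<open>M\<close> on \<open>S\<close>, and then \<open>f\<close> minus its
  linear part at \<open>z\<close> is estimated along the segment to \<open>y\<close>. This costs the
  factor 1/2 of Taylor's formula, which is immaterial.\<close>

lemma C2_on_supergradient:
  fixes f :: "'a::euclidean_space \<Rightarrow> real"
  assumes C2: "C2_on V f g H" and S: "convex S" "S \<subseteq> V"
    and M: "\<And>x. x \<in> S \<Longrightarrow> (\<Sum>i\<in>Basis. \<Sum>j\<in>Basis. \<bar>H x i \<bullet> j\<bar>) \<le> M"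
    and z: "z \<in> S"
  shows "supergradient_on S M f z (g z)"
  unfolding supergradient_on_def
proof
  fix y assume y: "y \<in> S"
  have df: "(f has_derivative (\<lambda>h. h \<bullet> g x)) (at x)" and dg: "(g has_derivative H x) (at x)"
    if "x \<in> S" for x
    using C2 that S(2) by (auto simp: C2_on_def gderiv_def)
  have onH: "onorm (H x) \<le> M" if x: "x \<in> S" for x
  proof (rule onorm_le)
    fix h
    interpret bounded_linear "H x" using dg[OF x] by (rule has_derivative_bounded_linear)
    have "H x h = H x (\<Sum>i\<in>Basis. (h \<bullet> i) *\<^sub>R i)" by (simp add: euclidean_representation)
    also have "\<dots> = (\<Sum>i\<in>Basis. (h \<bullet> i) *\<^sub>R H x i)" by (simp add: sum scaleR)
    finally have "norm (H x h) \<le> (\<Sum>i\<in>Basis. \<bar>h \<bullet> i\<bar> * norm (H x i))"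
      by (simp add: sum_norm_le)
    also have "\<dots> \<le> (\<Sum>i\<in>Basis. norm h * (\<Sum>j\<in>Basis. \<bar>H x i \<bullet> j\<bar>))"
      by (intro sum_mono mult_mono Basis_le_norm norm_le_l1) auto
    also have "\<dots> = (\<Sum>i\<in>Basis. \<Sum>j\<in>Basis. \<bar>H x i \<bullet> j\<bar>) * norm h"
      by (simp add: sum_distrib_left mult.commute)
    also have "\<dots> \<le> M * norm h" using M[OF x] by (intro mult_right_mono) auto
    finally show "norm (H x h) \<le> M * norm h" .
  qed
  have gl: "norm (g u - g z) \<le> M * norm (u - z)" if "u \<in> S" for u
    using differentiable_bound[OF S(1) has_derivative_at_withinI[OF dg] onH that z] .
  have M0: "0 \<le> M" using M[OF z] by (meson order_trans sum_nonneg abs_ge_zero)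
  \<comment> \<open>On the segment \<open>norm (x - z)\<close> is at most
    \<open>norm (y - z)\<close>, so the derivative of \<open>f u - u \<bullet> g z\<close> is
    bounded there by \<open>M * norm (y - z)\<close>.\<close>
  let ?s = "closed_segment z y"
  have s: "?s \<subseteq> S" using S(1) z y by (simp add: closed_segment_subset)
  have "norm ((f y - y \<bullet> g z) - (f z - z \<bullet> g z)) \<le> (M * norm (y - z)) * norm (y - z)"
  proof (rule differentiable_bound[where S = ?s and f = "\<lambda>u. f u - u \<bullet> g z"
        and f' = "\<lambda>u h. h \<bullet> g u - h \<bullet> g z"])
    show "((\<lambda>u. f u - u \<bullet> g z) has_derivative (\<lambda>h. h \<bullet> g x - h \<bullet> g z)) (at x within ?s)"
      if "x \<in> ?s" for x
      using s that by (auto intro!: derivative_eq_intros has_derivative_at_withinI[OF df])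
    show "onorm (\<lambda>h. h \<bullet> g x - h \<bullet> g z) \<le> M * norm (y - z)" if "x \<in> ?s" for x
    proof (rule onorm_le)
      fix h
      have "norm (h \<bullet> g x - h \<bullet> g z) \<le> norm h * norm (g x - g z)"
        using Cauchy_Schwarz_ineq2[of h "g x - g z"] by (simp add: inner_diff_right)
      also have "\<dots> \<le> norm h * (M * norm (x - z))"
        using that s by (intro mult_left_mono gl) auto
      also have "\<dots> \<le> norm h * (M * norm (y - z))"
        using segment_bound(1)[OF that] M0 by (intro mult_left_mono) (auto simp: norm_minus_commute)
      finally show "norm (h \<bullet> g x - h \<bullet> g z) \<le> M * norm (y - z) * norm h"
        by (simp add: mult.commute)
    qed
  qed auto
  then show "f y \<le> f z + g z \<bullet> (y - z) + M * (norm (y - z))\<^sup>2"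
    by (simp add: inner_diff_right inner_commute power2_eq_square)
qed

text \<open>A piece \<open>f c\<close> active at \<open>z\<close> lies above \<open>\<phi>\<close>
  and touches it at \<open>z\<close>, so the gradient of this piece is a supergradient of
  \<open>\<phi>\<close>. Compactness of the closed ball times \<open>C\<close> bounds gradients and
  Hessians independently of \<open>c\<close> and \<open>z\<close>.\<close>

lemma upper_C2_on_imp_superdifferentiable_on:
  fixes \<phi> :: "'a::euclidean_space \<Rightarrow> real"
  assumes "upper_C2_on TYPE('c) U \<phi>" "xb \<in> U"
  obtains \<delta> \<kappa> L where "\<delta> > 0" "\<kappa> > 0" "superdifferentiable_on (ball xb \<delta>) \<kappa> L \<phi>"
proof -
  obtain V and T :: "'c topology" and C f g H where V: "open V" "xb \<in> V" "compactin T C"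
    and \<phi>: "\<forall>x\<in>V. (\<exists>c\<in>C. \<phi> x = f c x) \<and> (\<forall>c\<in>C. \<phi> x \<le> f c x)"
    and C2: "\<forall>c\<in>C. C2_on V (f c) (g c) (H c)"
    and cg: "\<forall>i\<in>Basis. continuous_map (prod_topology (top_of_set V) (subtopology T C))
      euclideanreal (\<lambda>(x, c). g c x \<bullet> i)"
    and cH: "\<forall>i\<in>Basis. \<forall>j\<in>Basis.
      continuous_map (prod_topology (top_of_set V) (subtopology T C))
      euclideanreal (\<lambda>(x, c). H c x i \<bullet> j)"
    using bspec[OF assms(1)[unfolded upper_C2_on_def Let_def] assms(2)]
    by (elim exE conjE) (rule that)
  obtain \<delta> where \<delta>: "\<delta> > 0" "cball xb \<delta> \<subseteq> V"
    using V open_contains_cball by blast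
  note bd = continuous_map_bounded_on_compactin_prod[OF _ compact_cball \<delta>(2) V(3)]
  have "\<exists>L\<ge>0. \<forall>x\<in>cball xb \<delta>. \<forall>c\<in>C. (\<Sum>i\<in>Basis. \<bar>g c x \<bullet> i\<bar>) \<le> L"
    using bd[OF bspec[OF cg]] by (intro uniform_bound_over_finite) auto
  then obtain L where L: "\<And>x c. x \<in> cball xb \<delta> \<Longrightarrow> c \<in> C \<Longrightarrow> (\<Sum>i\<in>Basis. \<bar>g c x \<bullet> i\<bar>) \<le> L"
    by blast
  have "\<exists>M\<ge>0. \<forall>x\<in>cball xb \<delta>. \<forall>c\<in>C. (\<Sum>ij\<in>Basis\<times>Basis. \<bar>H c x (fst ij) \<bullet> snd ij\<bar>) \<le> M"
    using bd[OF bspec[OF bspec[OF cH]]] by (intro uniform_bound_over_finite) auto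
  then obtain M where M: "M \<ge> 0" "\<And>x c. x \<in> cball xb \<delta> \<Longrightarrow> c \<in> C \<Longrightarrow>
      (\<Sum>ij\<in>Basis\<times>Basis. \<bar>H c x (fst ij) \<bullet> snd ij\<bar>) \<le> M"
    by blast
  \<comment> \<open>\<open>M\<close> may be zero; \<open>M + 1\<close> supplies the strictly
    positive \<open>\<kappa>\<close>.\<close>
  have M': "(\<Sum>i\<in>Basis. \<Sum>j\<in>Basis. \<bar>H c x i \<bullet> j\<bar>) \<le> M + 1" if "x \<in> ball xb \<delta>" "c \<in> C" for x c
    using M(2)[of x c] that by (simp add: sum.cartesian_product case_prod_unfold)
  have "\<exists>g. norm g \<le> L \<and> supergradient_on (ball xb \<delta>) (M + 1) \<phi> z g" if z: "z \<in> ball xb \<delta>" for z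
  proof -
    have sub: "ball xb \<delta> \<subseteq> V" using \<delta>(2) ball_subset_cball by blast
    obtain c where c: "c \<in> C" "\<phi> z = f c z" using \<phi> z sub by blast
    have "supergradient_on (ball xb \<delta>) (M + 1) (f c) z (g c z)"
      using C2_on_supergradient[OF bspec[OF C2 c(1)] _ sub _ z] M' c(1) by simp
    then have "supergradient_on (ball xb \<delta>) (M + 1) \<phi> z (g c z)"
      using \<phi> sub c unfolding supergradient_on_def by (metis order_trans subsetD)
    moreover have "norm (g c z) \<le> L"
      using norm_le_l1[of "g c z"] L[of z c] z c(1) by simp
    ultimately show ?thesis by blast
  qed
  then show thesis
    using that[OF \<delta>(1), of "M + 1" L] M(1) by (auto simp: superdifferentiable_on_def)
qed

text \<open>A squeeze: the supergradient at \<open>xb\<close> bounds \<open>\<phi> y\<close> from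
  above, and the supergradients at \<open>y\<close>, evaluated at \<open>xb\<close>, bound it from
  below because their norms are at most \<open>L\<close>.\<close>

lemma superdifferentiable_on_isCont:
  assumes "superdifferentiable_on (ball xb \<delta>) \<kappa> L \<phi>" "\<delta> > 0"
  shows "isCont \<phi> xb"
proof -
  obtain g where g: "supergradient_on (ball xb \<delta>) \<kappa> \<phi> xb g"
    using superdifferentiable_onD[OF assms(1), of xb] assms(2) by auto
  have ev: "\<forall>\<^sub>F y in at xb. y \<in> ball xb \<delta>"
    using assms(2) by (intro eventually_at_in_open') auto
  have up: "\<forall>\<^sub>F y in at xb. \<phi> y \<le> \<phi> xb + g \<bullet> (y - xb) + \<kappa> * (norm (y - xb))\<^sup>2"
    using ev by eventually_elim (rule supergradient_onD[OF g])
  have lo: "\<forall>\<^sub>F y in at xb. \<phi> xb - L * norm (y - xb) - \<kappa> * (norm (y - xb))\<^sup>2 \<le> \<phi> y"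
    using ev
  proof eventually_elim
    case (elim y)
    then obtain v where v: "norm v \<le> L" "supergradient_on (ball xb \<delta>) \<kappa> \<phi> y v"
      using superdifferentiable_onD[OF assms(1)] by blast
    have "v \<bullet> (xb - y) \<le> norm v * norm (xb - y)" by (rule norm_cauchy_schwarz)
    also have "\<dots> \<le> L * norm (y - xb)"
      using v(1) by (simp add: mult_right_mono norm_minus_commute)
    finally show ?case
      using supergradient_onD[OF v(2), of xb] assms(2) by (simp add: norm_minus_commute)
  qed
  have "((\<lambda>y. \<phi> xb + g \<bullet> (y - xb) + \<kappa> * (norm (y - xb))\<^sup>2) \<longlongrightarrow> \<phi> xb) (at xb)"
    by (auto intro!: tendsto_eq_intros)
  moreover have "((\<lambda>y. \<phi> xb - L * norm (y - xb) - \<kappa> * (norm (y - xb))\<^sup>2) \<longlongrightarrow> \<phi> xb) (at xb)"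
    by (auto intro!: tendsto_eq_intros)
  ultimately show ?thesis
    unfolding isCont_def by (rule tendsto_sandwich[OF lo up, rotated])
qed

subsection \<open>Subgradients of superdifferentiable functions\<close>

text \<open>The supergradient at \<open>z\<close> is eliminated between the bounds for a short step backwards and a
  full step forwards, which makes the bound uniform in \<open>z\<close>.\<close>

lemma backward_quotient_le:
  assumes "superdifferentiable_on S \<kappa> L \<phi>" and t: "t > 0"
    and S: "z \<in> S" "z - t *\<^sub>R h \<in> S" "z + h \<in> S"
  shows "(\<phi> (z - t *\<^sub>R h) - \<phi> z) / t \<le> \<phi> z - \<phi> (z + h) + \<kappa> * (norm h)\<^sup>2 * (1 + t)"
proof -
  obtain g where g: "supergradient_on S \<kappa> \<phi> z g"
    using superdifferentiable_onD[OF assms(1) S(1)] by blast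
  have 1: "\<phi> (z - t *\<^sub>R h) - \<phi> z \<le> t * (- (g \<bullet> h) + \<kappa> * (norm h)\<^sup>2 * t)"
    using supergradient_onD[OF g S(2)] t by (simp add: algebra_simps power2_eq_square)
  have "\<phi> (z + h) \<le> \<phi> z + g \<bullet> h + \<kappa> * (norm h)\<^sup>2"
    using supergradient_onD[OF g S(3)] by simp
  then have "t * (- (g \<bullet> h) + \<kappa> * (norm h)\<^sup>2 * t)
      \<le> t * (\<phi> z - \<phi> (z + h) + \<kappa> * (norm h)\<^sup>2 * (1 + t))"
    using t by (intro mult_left_mono) (auto simp: algebra_simps)
  from order_trans[OF 1 this] show ?thesis
    using t by (simp only: pos_divide_le_eq mult.commute[of t])
qed

text \<open>The Clarke inequality is used in direction \<open>- h\<close>, so its quotients are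
  backward steps from base points \<open>u\<close> near \<open>z\<close>.
  \<open>backward_quotient_le\<close> bounds them by an expression free of the supergradient at
  \<open>u\<close>, whose limit follows from continuity of \<open>\<phi>\<close> at \<open>z\<close>
  and \<open>z + h\<close>.\<close>

lemma clarke_imp_supergradient_on:
  fixes \<phi> :: "'a::euclidean_space \<Rightarrow> real"
  assumes sd: "superdifferentiable_on S \<kappa> L \<phi>" and S: "open S" "z \<in> S"
    and cont: "\<And>x. isCont \<phi> x"
    and v: "v \<in> clarke_subdifferential \<phi> z"
  shows "supergradient_on S \<kappa> \<phi> z v"
  unfolding supergradient_on_def
proof
  fix y assume y: "y \<in> S"
  define h where "h = y - z"
  let ?F = "nhds z \<times>\<^sub>F at_right (0::real)"
  let ?b = "\<lambda>(u, t). \<phi> u - \<phi> (u + h) + \<kappa> * (norm h)\<^sup>2 * (1 + t)"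
  have f: "(fst \<longlongrightarrow> z) ?F" by (rule filterlim_fst)
  have s: "filterlim snd (at_right (0::real)) ?F" by (rule filterlim_snd)
  then have s0: "(snd \<longlongrightarrow> 0) ?F" "\<forall>\<^sub>F p in ?F. snd p > 0"
    by (auto simp: filterlim_at elim: eventually_mono)
  have zh: "z + h \<in> S" using y by (simp add: h_def)
  have "((\<lambda>p. fst p - snd p *\<^sub>R h) \<longlongrightarrow> z - 0 *\<^sub>R h) ?F"
    by (intro tendsto_diff tendsto_scaleR f s0 tendsto_const)
  then have zt: "((\<lambda>p. fst p - snd p *\<^sub>R h) \<longlongrightarrow> z) ?F" by simp
  have fh: "((\<lambda>p. fst p + h) \<longlongrightarrow> z + h) ?F"
    by (intro tendsto_add f tendsto_const)
  have "\<forall>\<^sub>F p in ?F. fst p - snd p *\<^sub>R h \<in> S" "\<forall>\<^sub>F p in ?F. fst p + h \<in> S"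
    "\<forall>\<^sub>F p in ?F. fst p \<in> S"
    using topological_tendstoD[OF zt S] topological_tendstoD[OF fh S(1) zh]
      topological_tendstoD[OF f S] .
  with s0(2) have ev: "\<forall>\<^sub>F p in ?F. (\<lambda>(u, t). ereal ((\<phi> (u + t *\<^sub>R (- h)) - \<phi> u) / t)) p \<le> ereal (?b p)"
  proof eventually_elim
    case (elim p)
    then show ?case
      using backward_quotient_le[OF sd, of "snd p" "fst p" h] by (simp add: case_prod_unfold)
  qed
  have "((\<lambda>p. \<phi> (fst p)) \<longlongrightarrow> \<phi> z) ?F"
    using isCont_tendsto_compose[OF cont f] .
  moreover have "((\<lambda>p. \<phi> (fst p + h)) \<longlongrightarrow> \<phi> (z + h)) ?F"
    using isCont_tendsto_compose[OF cont fh] .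
  ultimately have "((\<lambda>p. \<phi> (fst p) - \<phi> (fst p + h) + \<kappa> * (norm h)\<^sup>2 * (1 + snd p))
      \<longlongrightarrow> \<phi> z - \<phi> (z + h) + \<kappa> * (norm h)\<^sup>2 * (1 + 0)) ?F"
    by (intro tendsto_add tendsto_diff tendsto_mult tendsto_const s0)
  then have "((\<lambda>p. ereal (?b p)) \<longlongrightarrow> ereal (\<phi> z - \<phi> y + \<kappa> * (norm h)\<^sup>2)) ?F"
    by (simp add: case_prod_unfold h_def)
  moreover have nt: "?F \<noteq> bot" by (simp add: prod_filter_eq_bot)
  ultimately have "Limsup ?F (\<lambda>p. ereal (?b p)) = ereal (\<phi> z - \<phi> y + \<kappa> * (norm h)\<^sup>2)"
    by (intro lim_imp_Limsup)
  moreover have "ereal (v \<bullet> (- h)) \<le> Limsup ?F (\<lambda>p. ereal (?b p))"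
    using order_trans[OF spec[OF v[unfolded clarke_subdifferential_def clarke_derivative_def
      mem_Collect_eq], of "- h"] Limsup_mono[OF ev]] .
  ultimately have "v \<bullet> (- h) \<le> \<phi> z - \<phi> y + \<kappa> * (norm h)\<^sup>2" by simp
  then show "\<phi> y \<le> \<phi> z + v \<bullet> (y - z) + \<kappa> * (norm (y - z))\<^sup>2"
    by (simp add: h_def inner_diff_right)
qed

text \<open>The base point in the Clarke derivative may move: with base point
  \<open>z - t *\<^sub>R h\<close> the step \<open>t *\<^sub>R h\<close> ends at \<open>z\<close>,
  and the supergradient inequality bounds the quotient from below. This converse is what closes the
  graph of the Clarke subdifferential.\<close>

lemma supergradient_on_imp_clarke:
  fixes \<phi> :: "'a::euclidean_space \<Rightarrow> real"
  assumes v: "supergradient_on S \<kappa> \<phi> z v" and S: "open S" "z \<in> S"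
  shows "v \<in> clarke_subdifferential \<phi> z"
  unfolding clarke_subdifferential_def clarke_derivative_def
proof (intro CollectI allI)
  fix h
  let ?F = "nhds z \<times>\<^sub>F at_right (0::real)"
  let ?f = "\<lambda>(u, t). ereal ((\<phi> (u + t *\<^sub>R h) - \<phi> u) / t)"
  let ?m = "\<lambda>t. (z - t *\<^sub>R h, t)"
  let ?b = "\<lambda>t. v \<bullet> h - \<kappa> * (norm h)\<^sup>2 * t"
  have t0: "((\<lambda>t. t) \<longlongrightarrow> (0::real)) (at_right 0)" by (rule tendsto_ident_at)
  have zt: "((\<lambda>t. z - t *\<^sub>R h) \<longlongrightarrow> z) (at_right 0)"
    using t0 by (auto intro!: tendsto_eq_intros)
  have m: "filterlim ?m ?F (at_right 0)"
    using zt by (intro filterlim_Pair) (auto simp: filterlim_ident)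
  have "\<forall>\<^sub>F t in at_right 0. z - t *\<^sub>R h \<in> S" using topological_tendstoD[OF zt S] .
  with eventually_at_right_less[of 0] have ev: "\<forall>\<^sub>F t in at_right 0. ereal (?b t) \<le> ?f (?m t)"
  proof eventually_elim
    case (elim t)
    have "t * ?b t \<le> \<phi> z - \<phi> (z - t *\<^sub>R h)"
      using supergradient_onD[OF v elim(2)] elim(1) by (simp add: algebra_simps power2_eq_square)
    then have "?b t \<le> (\<phi> z - \<phi> (z - t *\<^sub>R h)) / t"
      using elim(1) by (simp add: le_divide_eq mult.commute)
    then show ?case by simp
  qed
  have "(?b \<longlongrightarrow> v \<bullet> h) (at_right 0)" using t0 by (auto intro!: tendsto_eq_intros)
  then have lim: "((\<lambda>t. ereal (?b t)) \<longlongrightarrow> ereal (v \<bullet> h)) (at_right 0)" by simp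
  have "ereal (v \<bullet> h) = Limsup (at_right 0) (\<lambda>t. ereal (?b t))"
    by (rule lim_imp_Limsup[OF _ lim, symmetric]) simp
  also have "\<dots> \<le> Limsup (at_right 0) (\<lambda>t. ?f (?m t))" using Limsup_mono[OF ev] .
  also have "\<dots> \<le> Limsup (filtermap ?m (at_right 0)) ?f" by (rule Limsup_filtermap_ge)
  \<comment> \<open>The image filter of the curve \<open>?m\<close> is finer than \<open>?F\<close>,
    and \<open>Limsup\<close> is monotone in the filter.\<close>
  also have "\<dots> \<le> Limsup ?F ?f"
    using m unfolding filterlim_def Limsup_def le_filter_def by (intro INF_superset_mono) auto
  finally show "ereal (v \<bullet> h) \<le> Limsup ?F ?f" .
qed

text \<open>The defining quotient is tested along \<open>z - t *\<^sub>R h\<close> as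
  \<open>t\<close> decreases to 0, and the resulting backward quotient is bounded by
  \<open>backward_quotient_le\<close> at the fixed base point \<open>z\<close>.\<close>

lemma regular_imp_supergradient_on:
  fixes \<phi> :: "'a::euclidean_space \<Rightarrow> real"
  assumes sd: "superdifferentiable_on S \<kappa> L \<phi>" and S: "open S" "z \<in> S"
    and v: "v \<in> regular_subdifferential \<phi> z"
  shows "supergradient_on S \<kappa> \<phi> z v"
  unfolding supergradient_on_def
proof
  fix y assume y: "y \<in> S"
  define h where "h = y - z"
  have "v \<bullet> (- h) \<le> \<phi> z - \<phi> y + \<kappa> * (norm h)\<^sup>2"
  proof (cases "h = 0")
    case False
    show ?thesis
    proof (rule field_le_epsilon)
      fix e :: real assume e: "e > 0"
      \<comment> \<open>The regular quotient divides by \<open>t * norm h\<close>, so the tolerance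
        \<open>e'\<close> becomes \<open>t * e\<close> after multiplying out.\<close>
      define e' where "e' = e / norm h"
      have e': "e' > 0" "e' * norm h = e" using e False by (auto simp: e'_def)
      have "ereal (- e') < Liminf (at z) (\<lambda>y. ereal ((\<phi> y - \<phi> z - v \<bullet> (y - z)) / norm (y - z)))"
        using v e'(1) by (auto simp: regular_subdifferential_def intro: less_le_trans[of _ 0])
      from less_LiminfD[OF this]
      have ev: "\<forall>\<^sub>F y in at z. - e' < (\<phi> y - \<phi> z - v \<bullet> (y - z)) / norm (y - z)" by simp
      have t0: "((\<lambda>t. t) \<longlongrightarrow> (0::real)) (at_right 0)" by (rule tendsto_ident_at)
      have zt: "((\<lambda>t. z - t *\<^sub>R h) \<longlongrightarrow> z) (at_right 0)"
        using t0 by (auto intro!: tendsto_eq_intros)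
      then have "filterlim (\<lambda>t. z - t *\<^sub>R h) (at z) (at_right 0)"
        using False eventually_at_right_less[of 0]
        by (auto simp: filterlim_at elim: eventually_mono)
      from eventually_compose_filterlim[OF ev this] topological_tendstoD[OF zt S]
        eventually_at_right_less[of 0]
      have "\<forall>\<^sub>F t in at_right 0. v \<bullet> (- h) - e \<le> \<phi> z - \<phi> y + \<kappa> * (norm h)\<^sup>2 * (1 + t)"
      proof eventually_elim
        case (elim t)
        have "- e' * (t * norm h) < \<phi> (z - t *\<^sub>R h) - \<phi> z + t * (v \<bullet> h)"
          using elim False by (simp add: less_divide_eq)
        then have "t * (v \<bullet> (- h) - e) \<le> \<phi> (z - t *\<^sub>R h) - \<phi> z"
          using e'(2) by (simp add: algebra_simps)
        then have "v \<bullet> (- h) - e \<le> (\<phi> (z - t *\<^sub>R h) - \<phi> z) / t"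
          using elim(3) by (simp add: le_divide_eq mult.commute)
        also have "\<dots> \<le> \<phi> z - \<phi> (z + h) + \<kappa> * (norm h)\<^sup>2 * (1 + t)"
          using elim S(2) y by (intro backward_quotient_le[OF sd]) (auto simp: h_def)
        finally show ?case by (simp add: h_def)
      qed
      moreover have "((\<lambda>t. \<phi> z - \<phi> y + \<kappa> * (norm h)\<^sup>2 * (1 + t)) \<longlongrightarrow> \<phi> z - \<phi> y + \<kappa> * (norm h)\<^sup>2)
          (at_right 0)"
        using t0 by (auto intro!: tendsto_eq_intros)
      ultimately have "v \<bullet> (- h) - e \<le> \<phi> z - \<phi> y + \<kappa> * (norm h)\<^sup>2"
        by (intro tendsto_le[OF _ _ tendsto_const]) auto
      then show "v \<bullet> (- h) \<le> \<phi> z - \<phi> y + \<kappa> * (norm h)\<^sup>2 + e" by simp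
    qed
  qed (simp add: h_def)
  then show "\<phi> y \<le> \<phi> z + v \<bullet> (y - z) + \<kappa> * (norm (y - z))\<^sup>2"
    by (simp add: h_def inner_diff_right)
qed

lemma supergradient_on_closed:
  fixes \<phi> :: "'a::euclidean_space \<Rightarrow> real"
  assumes "\<forall>\<^sub>F k in sequentially. supergradient_on S \<kappa> \<phi> (X k) (V k)"
    and X: "X \<longlonglongrightarrow> z" and V: "V \<longlonglongrightarrow> v" and cont: "isCont \<phi> z"
  shows "supergradient_on S \<kappa> \<phi> z v"
  unfolding supergradient_on_def
proof
  fix y assume y: "y \<in> S"
  have "(\<lambda>k. \<phi> (X k) + V k \<bullet> (y - X k) + \<kappa> * (norm (y - X k))\<^sup>2)
      \<longlonglongrightarrow> \<phi> z + v \<bullet> (y - z) + \<kappa> * (norm (y - z))\<^sup>2"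
    using X V isCont_tendsto_compose[OF cont X] by (auto intro!: tendsto_intros)
  moreover have "\<forall>\<^sub>F k in sequentially. \<phi> y \<le> \<phi> (X k) + V k \<bullet> (y - X k) + \<kappa> * (norm (y - X k))\<^sup>2"
    using assms(1) by eventually_elim (rule supergradient_onD[OF _ y])
  ultimately show "\<phi> y \<le> \<phi> z + v \<bullet> (y - z) + \<kappa> * (norm (y - z))\<^sup>2"
    by (intro tendsto_lowerbound) auto
qed

text \<open>The approximating regular subgradients eventually have base points in \<open>S\<close>,
  hence satisfy the inequality with the same \<open>\<kappa>\<close>, and the inequality is
  closed.\<close>

lemma limiting_imp_supergradient_on:
  fixes \<phi> :: "'a::euclidean_space \<Rightarrow> real"
  assumes sd: "superdifferentiable_on S \<kappa> L \<phi>" and S: "open S" "z \<in> S" and cont: "isCont \<phi> z"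
    and v: "v \<in> limiting_subdifferential \<phi> z"
  shows "supergradient_on S \<kappa> \<phi> z v"
proof -
  obtain X V where X: "X \<longlonglongrightarrow> z" and V: "V \<longlonglongrightarrow> v"
    and reg: "\<And>k. V k \<in> regular_subdifferential \<phi> (X k)"
    using v by (auto simp: limiting_subdifferential_def)
  have "\<forall>\<^sub>F k in sequentially. supergradient_on S \<kappa> \<phi> (X k) (V k)"
    using topological_tendstoD[OF X S]
    by eventually_elim (rule regular_imp_supergradient_on[OF sd S(1) _ reg])
  then show ?thesis using X V cont by (rule supergradient_on_closed)
qed

text \<open>A diagonal argument: each pair \<open>(X k, V k)\<close> is replaced by a nearby pair
  with a regular subgradient. Continuity of \<open>\<phi>\<close> supplies the convergence of
  function values.\<close>

lemma limiting_subdifferential_closed_graph: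
  fixes \<phi> :: "'a::euclidean_space \<Rightarrow> real"
  assumes cont: "\<And>x. isCont \<phi> x" and X: "X \<longlonglongrightarrow> z" and V: "V \<longlonglongrightarrow> v"
    and mem: "\<And>k. V k \<in> limiting_subdifferential \<phi> (X k)"
  shows "v \<in> limiting_subdifferential \<phi> z"
proof -
  have "\<exists>x' v'. dist x' (X k) < inverse (Suc k) \<and> dist v' (V k) < inverse (Suc k) \<and>
      v' \<in> regular_subdifferential \<phi> x'" for k
  proof -
    obtain A B where A: "A \<longlonglongrightarrow> X k" and B: "B \<longlonglongrightarrow> V k"
      and reg: "\<And>i. B i \<in> regular_subdifferential \<phi> (A i)"
      using mem[of k] by (auto simp: limiting_subdifferential_def)
    have "\<forall>\<^sub>F i in sequentially. dist (A i) (X k) < inverse (Suc k) \<and> dist (B i) (V k) < inverse (Suc k)"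
      by (intro eventually_conj tendstoD[OF A] tendstoD[OF B]) auto
    then obtain i where "dist (A i) (X k) < inverse (Suc k)" "dist (B i) (V k) < inverse (Suc k)"
      using eventually_happens' trivial_limit_sequentially by blast
    with reg show ?thesis by blast
  qed
  then obtain X' V' where X': "\<And>k. dist (X' k) (X k) < inverse (Suc k)"
    and V': "\<And>k. dist (V' k) (V k) < inverse (Suc k)"
    and reg: "\<And>k. V' k \<in> regular_subdifferential \<phi> (X' k)" by metis
  have close: "A' \<longlonglongrightarrow> a" if "\<And>k. dist (A' k) (A k) < inverse (Suc k)" "A \<longlonglongrightarrow> a"
    for A' A :: "nat \<Rightarrow> 'a" and a
  proof -
    have "(\<lambda>k. dist (A' k) (A k)) \<longlonglongrightarrow> 0"
      by (rule tendsto_sandwich[OF _ _ tendsto_const LIMSEQ_inverse_real_of_nat])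
        (use that(1) in \<open>auto intro: always_eventually less_imp_le\<close>)
    then have "(\<lambda>k. A' k - A k) \<longlonglongrightarrow> 0" by (simp add: dist_norm tendsto_norm_zero_iff)
    from tendsto_add[OF this that(2)] show ?thesis by simp
  qed
  have "X' \<longlonglongrightarrow> z" using X' X by (rule close)
  moreover have "V' \<longlonglongrightarrow> v" using V' V by (rule close)
  moreover have "(\<lambda>k. \<phi> (X' k)) \<longlonglongrightarrow> \<phi> z"
    using isCont_tendsto_compose[OF cont] calculation(1) .
  ultimately show ?thesis using reg by (auto simp: limiting_subdifferential_def)
qed

text \<open>Move from \<open>z\<close> by \<open>\<delta> / 2\<close> against \<open>v\<close>,
  staying in the ball, and return with a supergradient at \<open>y\<close> of norm at most
  \<open>L\<close>. Adding the two inequalities cancels the values of \<open>\<phi>\<close> and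
  leaves a bound on \<open>norm v\<close>. The absolute values keep the bound nonnegative for
  \<open>v = 0\<close>.\<close>

lemma superdifferentiable_on_supergradient_bounded:
  fixes \<phi> :: "'a::euclidean_space \<Rightarrow> real"
  assumes sd: "superdifferentiable_on (ball xb \<delta>) \<kappa> L \<phi>" and "\<delta> > 0"
    and z: "z \<in> ball xb (\<delta> / 2)" and v: "supergradient_on (ball xb \<delta>) \<kappa> \<phi> z v"
  shows "norm v \<le> \<bar>L\<bar> + \<bar>\<kappa>\<bar> * \<delta>"
proof (cases "v = 0")
  case False
  define r where "r = \<delta> / 2"
  define y where "y = z - (r / norm v) *\<^sub>R v"
  have r: "r > 0" using assms(2) by (simp add: r_def)
  have yz: "norm (y - z) = r" "norm (z - y) = r" and vy: "v \<bullet> (y - z) = - (r * norm v)"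
    using r False by (simp_all add: y_def dot_square_norm power2_eq_square)
  have "dist xb y \<le> dist xb z + dist z y" by (rule dist_triangle)
  then have y: "y \<in> ball xb \<delta>" and zin: "z \<in> ball xb \<delta>"
    using z yz assms(2) by (auto simp: dist_norm r_def)
  obtain g where g: "norm g \<le> L" "supergradient_on (ball xb \<delta>) \<kappa> \<phi> y g"
    using superdifferentiable_onD[OF sd y] by blast
  have "g \<bullet> (z - y) \<le> norm g * norm (z - y)" by (rule norm_cauchy_schwarz)
  also have "\<dots> \<le> L * r" using g(1) r by (simp add: yz)
  finally have "r * norm v \<le> L * r + 2 * \<kappa> * r\<^sup>2"
    using supergradient_onD[OF v y] supergradient_onD[OF g(2) zin] by (simp add: yz vy)
  then have "r * norm v \<le> r * (L + \<kappa> * \<delta>)"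
    by (simp add: r_def power2_eq_square algebra_simps)
  then have "norm v \<le> L + \<kappa> * \<delta>" using r by simp
  also have "\<dots> \<le> \<bar>L\<bar> + \<bar>\<kappa>\<bar> * \<delta>" using assms(2) by (intro add_mono mult_right_mono) auto
  finally show ?thesis .
qed (use assms(2) in simp)

subsection \<open>Projection steps\<close>

lemma proj_set_iff: "y \<in> proj_set D x \<longleftrightarrow> y \<in> D \<and> (\<forall>z\<in>D. norm (x - y) \<le> norm (x - z))"
proof -
  have bdd: "bdd_below ((\<lambda>z. norm (x - z)) ` D)" by (rule bdd_belowI[of _ 0]) auto
  have "norm (x - y) = (INF z\<in>D. norm (x - z)) \<longleftrightarrow> (\<forall>z\<in>D. norm (x - y) \<le> norm (x - z))" if y: "y \<in> D"
  proof
    assume "\<forall>z\<in>D. norm (x - y) \<le> norm (x - z)"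
    then have "norm (x - y) \<le> (INF z\<in>D. norm (x - z))" using y by (intro cINF_greatest) auto
    then show "norm (x - y) = (INF z\<in>D. norm (x - z))"
      using cINF_lower[OF bdd y] by simp
  qed (use cINF_lower[OF bdd] in simp)
  then show ?thesis by (auto simp: proj_set_def)
qed

text \<open>The point \<open>x\<close> itself competes in the projection onto \<open>D\<close>;
  expanding the squares gives the first inequality. The others follow by its sign and by
  Cauchy-Schwarz.\<close>

lemma projection_step:
  assumes y: "y \<in> proj_set D (x - t *\<^sub>R w)" and x: "x \<in> D" and t: "t > 0"
  shows "(norm (y - x))\<^sup>2 + 2 * t * (w \<bullet> (y - x)) \<le> 0"
    and "w \<bullet> (y - x) \<le> 0" and "norm (y - x) \<le> 2 * t * norm w"
proof -
  have "norm (x - t *\<^sub>R w - y) \<le> norm (x - t *\<^sub>R w - x)"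
    using y x unfolding proj_set_iff by blast
  then have "(norm ((y - x) + t *\<^sub>R w))\<^sup>2 \<le> (norm (t *\<^sub>R w))\<^sup>2"
    by (intro power_mono) (auto simp: algebra_simps norm_minus_commute)
  then show *: "(norm (y - x))\<^sup>2 + 2 * t * (w \<bullet> (y - x)) \<le> 0"
    unfolding power2_norm_eq_inner by (simp add: inner_add_left inner_add_right inner_commute)
  then have "2 * t * (w \<bullet> (y - x)) \<le> 0" using zero_le_power2[of "norm (y - x)"] by linarith
  then show "w \<bullet> (y - x) \<le> 0" using t by (simp add: mult_le_0_iff)
  have "- (w \<bullet> (y - x)) \<le> norm w * norm (y - x)"
    using Cauchy_Schwarz_ineq2[of w "y - x"] by linarith
  then have "2 * t * - (w \<bullet> (y - x)) \<le> 2 * t * (norm w * norm (y - x))"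
    using t by (intro mult_left_mono) auto
  then have "norm (y - x) * norm (y - x) \<le> (2 * t * norm w) * norm (y - x)"
    using * by (simp add: power2_eq_square algebra_simps)
  then show "norm (y - x) \<le> 2 * t * norm w"
    using t by (cases "y = x") auto
qed

text \<open>The threshold \<open>s0\<close> depends only on the local data around \<open>xb\<close>,
  not on \<open>x\<close>, \<open>v\<close>, \<open>y\<close> or \<open>R\<close>. It serves both to
  end the while loop at one iterate and to bound accepted steps from below near an accumulation
  point.\<close>

lemma small_steps_accepted:
  fixes \<phi> :: "'a::euclidean_space \<Rightarrow> real"
  assumes sd: "superdifferentiable_on (ball xb \<delta>) \<kappa> L \<phi>" and \<delta>: "\<delta> > 0" and \<kappa>: "\<kappa> > 0"
    and \<sigma>: "\<sigma> < 1"
  obtains s0 where "s0 > 0"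
    "\<And>x v s y R. x \<in> D \<Longrightarrow> x \<in> ball xb (\<delta> / 2) \<Longrightarrow> supergradient_on (ball xb \<delta>) \<kappa> \<phi> x v \<Longrightarrow>
      0 < s \<Longrightarrow> s \<le> s0 \<Longrightarrow> y \<in> proj_set D (x - s *\<^sub>R v) \<Longrightarrow> \<phi> x \<le> R \<Longrightarrow>
      \<phi> y \<le> R + \<sigma> * (v \<bullet> (y - x))"
proof -
  define B where "B = \<bar>L\<bar> + \<bar>\<kappa>\<bar> * \<delta>"
  have B: "B > 0" using \<delta> \<kappa> by (simp add: B_def add_nonneg_pos)
  \<comment> \<open>The first bound keeps the trial point within \<open>\<delta> / 2\<close> of
    \<open>x\<close>, hence in the ball; the second yields
    \<open>2 * \<kappa> * s \<le> 1 - \<sigma>\<close>.\<close>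
  define s0 where "s0 = min (\<delta> / (4 * B)) ((1 - \<sigma>) / (2 * \<kappa>))"
  show thesis
  proof (rule that)
    show "s0 > 0" using \<delta> \<kappa> \<sigma> B by (simp add: s0_def)
    fix x v s y and R :: real
    assume x: "x \<in> D" "x \<in> ball xb (\<delta> / 2)" and v: "supergradient_on (ball xb \<delta>) \<kappa> \<phi> x v"
      and s: "0 < s" "s \<le> s0" and y: "y \<in> proj_set D (x - s *\<^sub>R v)" and R: "\<phi> x \<le> R"
    note step = projection_step[OF y x(1) s(1)]
    have "norm v \<le> B"
      unfolding B_def by (rule superdifferentiable_on_supergradient_bounded[OF sd \<delta> x(2) v])
    then have "2 * s * norm v \<le> 2 * s0 * B" using s by (intro mult_mono) auto
    also have "\<dots> \<le> \<delta> / 2" using B by (simp add: s0_def min_def field_simps)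
    finally have "dist x y \<le> \<delta> / 2" using step(3) by (simp add: dist_norm norm_minus_commute)
    then have "y \<in> ball xb \<delta>" using x(2) dist_triangle[of xb y x] by simp
    from supergradient_onD[OF v this]
    have "\<phi> y \<le> \<phi> x + v \<bullet> (y - x) + \<kappa> * (norm (y - x))\<^sup>2" .
    \<comment> \<open>The projection inequality turns the quadratic error into a multiple of the
      predicted decrease, which the slack \<open>1 - \<sigma>\<close> absorbs.\<close>
    moreover have "\<kappa> * (norm (y - x))\<^sup>2 \<le> \<kappa> * (2 * s * - (v \<bullet> (y - x)))"
      using step(1) \<kappa> by (intro mult_left_mono) auto
    moreover have "s \<le> (1 - \<sigma>) / (2 * \<kappa>)" using s(2) by (simp add: s0_def)
    then have "2 * \<kappa> * s \<le> 1 - \<sigma>" using \<kappa> by (simp add: field_simps)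
    then have "(2 * \<kappa> * s) * - (v \<bullet> (y - x)) \<le> (1 - \<sigma>) * - (v \<bullet> (y - x))"
      using step(2) by (intro mult_right_mono) auto
    ultimately show "\<phi> y \<le> R + \<sigma> * (v \<bullet> (y - x))" using R by (simp add: algebra_simps)
  qed
qed

text \<open>The distance inequality against each fixed \<open>z\<close> in \<open>D\<close> is
  closed under limits, and the limiting step size \<open>\<tau>\<close> is the witness in the cone.
  This is why step sizes must stay away from 0.\<close>

lemma proximal_normal_cone_limit:
  fixes D :: "'a::euclidean_space set"
  assumes D: "closed D" and y: "\<And>k. Y k \<in> proj_set D (X k - t k *\<^sub>R W k)"
    and lim: "X \<longlonglongrightarrow> x" "Y \<longlonglongrightarrow> x" "W \<longlonglongrightarrow> w" "t \<longlonglongrightarrow> \<tau>" and \<tau>: "\<tau> > 0"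
  shows "- w \<in> proximal_normal_cone D x"
proof -
  have "x \<in> D" using closed_sequentially[OF D _ lim(2)] y by (auto simp: proj_set_iff)
  moreover have "norm (x - \<tau> *\<^sub>R w - x) \<le> norm (x - \<tau> *\<^sub>R w - z)" if "z \<in> D" for z
  proof (rule LIMSEQ_le)
    show "(\<lambda>k. norm (X k - t k *\<^sub>R W k - Y k)) \<longlonglongrightarrow> norm (x - \<tau> *\<^sub>R w - x)"
      by (intro tendsto_intros lim)
    show "(\<lambda>k. norm (X k - t k *\<^sub>R W k - z)) \<longlonglongrightarrow> norm (x - \<tau> *\<^sub>R w - z)"
      by (intro tendsto_intros lim)
    show "\<exists>N. \<forall>k\<ge>N. norm (X k - t k *\<^sub>R W k - Y k) \<le> norm (X k - t k *\<^sub>R W k - z)"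
      using y that by (auto simp: proj_set_iff)
  qed
  ultimately show ?thesis
    using \<tau> by (auto simp: proximal_normal_cone_def proj_set_iff intro!: exI[of _ \<tau>])
qed

subsection \<open>Convergence of the method\<close>

text \<open>The scalar core of the method, with \<open>a k\<close> the function value and
  \<open>d k\<close> the step length. Each decrease of \<open>R\<close> is at least
  \<open>pmin\<close> times the gap \<open>R k - a (Suc k)\<close>, which dominates
  \<open>c * (d k)\<^sup>2\<close>; convergence of \<open>R\<close> therefore forces both to
  0.\<close>

lemma nonmonotone_descent_converges:
  fixes R a d :: "nat \<Rightarrow> real"
  assumes R: "\<And>k. R (Suc k) = (1 - p (Suc k)) * R k + p (Suc k) * a (Suc k)"
    and p: "\<And>k. p (Suc k) \<in> {pmin..1}" "0 < pmin"
    and desc: "\<And>k. a (Suc k) \<le> R k - c * (d k)\<^sup>2" "0 < c"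
    and bdd: "a 0 = R 0" "bdd_below (range a)"
  obtains l where "decseq R" "R \<longlonglongrightarrow> l" "a \<longlonglongrightarrow> l" "d \<longlonglongrightarrow> 0"
proof -
  have eq: "R k - R (Suc k) = p (Suc k) * (R k - a (Suc k))" for k
    by (simp add: R algebra_simps)
  have Ra: "c * (d k)\<^sup>2 \<le> R k - a (Suc k)" "0 \<le> R k - a (Suc k)" for k
  proof -
    have "0 \<le> c * (d k)\<^sup>2" using desc(2) by simp
    then show "c * (d k)\<^sup>2 \<le> R k - a (Suc k)" "0 \<le> R k - a (Suc k)"
      using desc(1)[of k] by linarith+
  qed
  have gap: "pmin * (R k - a (Suc k)) \<le> R k - R (Suc k)" for k
    unfolding eq using p(1)[of k] Ra(2)[of k] by (intro mult_right_mono) auto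
  have dec: "decseq R"
  proof (rule decseq_SucI)
    show "R (Suc k) \<le> R k" for k
      using gap[of k] mult_nonneg_nonneg[of pmin "R k - a (Suc k)"] p(2) Ra(2)[of k] by linarith
  qed
  \<comment> \<open>\<open>R (Suc j)\<close> is a convex combination of \<open>R j\<close> and the
    smaller \<open>a (Suc j)\<close>. Thus a lower bound of \<open>a\<close> is one of
    \<open>R\<close>.\<close>
  have aR: "a k \<le> R k" for k
  proof (cases k)
    case (Suc j)
    have "R (Suc j) - a (Suc j) = (1 - p (Suc j)) * (R j - a (Suc j))"
      by (simp add: R algebra_simps)
    also have "\<dots> \<ge> 0" using p(1)[of j] Ra(2)[of j] by (intro mult_nonneg_nonneg) auto
    finally show ?thesis using Suc by simp
  qed (use bdd in simp)
  obtain m where "\<And>k. m \<le> a k" using bdd(2) by (auto simp: bdd_below_def)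
  then have "\<forall>k. m \<le> R k" using aR order_trans by blast
  from decseq_convergent[OF dec this] obtain l where l: "R \<longlonglongrightarrow> l" by blast
  have l': "(\<lambda>k. R (Suc k)) \<longlonglongrightarrow> l" using l by (rule LIMSEQ_Suc)
  have "(\<lambda>k. (R k - R (Suc k)) / pmin) \<longlonglongrightarrow> (l - l) / pmin"
    by (intro tendsto_divide tendsto_diff l l' tendsto_const) (use p in auto)
  then have q: "(\<lambda>k. (R k - R (Suc k)) / pmin) \<longlonglongrightarrow> 0" by simp
  have g0: "(\<lambda>k. R k - a (Suc k)) \<longlonglongrightarrow> 0"
  proof (rule tendsto_sandwich[OF _ _ tendsto_const q])
    show "\<forall>\<^sub>F k in sequentially. R k - a (Suc k) \<le> (R k - R (Suc k)) / pmin"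
      using gap p(2) by (simp add: field_simps)
  qed (use Ra(2) in simp)
  from tendsto_diff[OF l g0] have "(\<lambda>k. a (Suc k)) \<longlonglongrightarrow> l" by simp
  then have a: "a \<longlonglongrightarrow> l" by (rule LIMSEQ_imp_Suc)
  have "(\<lambda>k. (R k - a (Suc k)) / c) \<longlonglongrightarrow> 0 / c"
    by (intro tendsto_divide g0 tendsto_const) (use desc(2) in auto)
  then have "(\<lambda>k. (R k - a (Suc k)) / c) \<longlonglongrightarrow> 0" by simp
  then have "(\<lambda>k. (d k)\<^sup>2) \<longlonglongrightarrow> 0"
    by (rule tendsto_sandwich[OF _ _ tendsto_const, rotated 2])
      (use Ra(1) desc(2) in \<open>auto simp: field_simps\<close>)
  then have "d \<longlonglongrightarrow> 0" by simp
  then show thesis using that dec l a by blast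
qed

lemma subdifferential_supergradient_on:
  fixes \<phi> :: "'a::euclidean_space \<Rightarrow> real"
  assumes "subdiff = limiting_subdifferential \<or> subdiff = clarke_subdifferential"
    and "superdifferentiable_on S \<kappa> L \<phi>" "open S" "z \<in> S" "\<And>x. isCont \<phi> x" "v \<in> subdiff \<phi> z"
  shows "supergradient_on S \<kappa> \<phi> z v"
  using assms clarke_imp_supergradient_on limiting_imp_supergradient_on by metis

text \<open>For Clarke subgradients the detour is through supergradients: pass to them, take the
  limit there, and return by \<open>supergradient_on_imp_clarke\<close>.\<close>

lemma subdifferential_closed_graph:
  fixes \<phi> :: "'a::euclidean_space \<Rightarrow> real"
  assumes sub: "subdiff = limiting_subdifferential \<or> subdiff = clarke_subdifferential"
    and sd: "superdifferentiable_on S \<kappa> L \<phi>" "open S" "z \<in> S" and cont: "\<And>x. isCont \<phi> x"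
    and X: "X \<longlonglongrightarrow> z" and V: "V \<longlonglongrightarrow> v" and mem: "\<And>k. V k \<in> subdiff \<phi> (X k)"
  shows "v \<in> subdiff \<phi> z"
  using sub
proof
  assume "subdiff = limiting_subdifferential"
  then show ?thesis using limiting_subdifferential_closed_graph[OF cont X V] mem by simp
next
  assume c: "subdiff = clarke_subdifferential"
  have "\<forall>\<^sub>F k in sequentially. supergradient_on S \<kappa> \<phi> (X k) (V k)"
    using topological_tendstoD[OF X sd(2,3)]
    by eventually_elim (rule subdifferential_supergradient_on[OF sub sd(1,2) _ cont mem])
  from supergradient_on_closed[OF this X V cont] show ?thesis
    using supergradient_on_imp_clarke[OF _ sd(2,3)] c by simp
qed

theorem theorem3p5:
  fixes D :: "'a::euclidean_space set"
    and \<phi> :: "'a \<Rightarrow> real"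
    and subdiff :: "('a \<Rightarrow> real) \<Rightarrow> 'a \<Rightarrow> 'a set"
    and \<tau>min \<tau>max \<sigma> \<beta> pmin :: real
    and stop :: "nat \<Rightarrow> bool"
    and N :: enat
    and x w :: "nat \<Rightarrow> 'a"
    and R p \<tau> :: "nat \<Rightarrow> real"
    and Y :: "nat \<Rightarrow> nat \<Rightarrow> 'a"
    and n :: "nat \<Rightarrow> enat"
  assumes "D \<noteq> {}" and "closed D"
    and "upper_C2_on TYPE('c) UNIV \<phi>"
    and "bdd_below (range \<phi>)"
    and "subdiff = limiting_subdifferential \<or> subdiff = clarke_subdifferential"
    and "0 < \<tau>min" and "\<tau>min \<le> \<tau>max"
    and "0 < \<sigma>" and "\<sigma> < 1"
    and "0 < \<beta>" and "\<beta> < 1"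
    and "0 < pmin" and "pmin \<le> 1"
    and "\<And>k. enat k \<le> N \<Longrightarrow> stop k \<Longrightarrow> - w k \<in> proximal_normal_cone D (x k)"
    and "NPSM_run (subdiff \<phi>) \<phi> D \<tau>min \<tau>max \<sigma> \<beta> pmin stop N x w R p \<tau> Y n"
  shows "(\<exists>k. N = enat k \<and> stop k \<and> - w k \<in> proximal_normal_cone D (x k)) \<or>
    (N = \<infinity> \<and>
     (\<forall>xs. accumulation_point x xs \<longrightarrow>
        (\<exists>ws \<in> subdiff \<phi> xs. - ws \<in> proximal_normal_cone D xs)) \<and>
     (\<forall>xs. accumulation_point x xs \<longrightarrow>
        (\<lambda>k. \<phi> (x k)) \<longlonglongrightarrow> \<phi> xs \<and> decseq R \<and> R \<longlonglongrightarrow> \<phi> xs))"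
proof -
  note D = assms(2) and sub = assms(5)
  note par = assms(6-13) and run = assms(15)[unfolded NPSM_run_def]
  have loc: "\<exists>\<delta> \<kappa> L. \<delta> > 0 \<and> \<kappa> > 0 \<and> superdifferentiable_on (ball a \<delta>) \<kappa> L \<phi>" for a
    using upper_C2_on_imp_superdifferentiable_on[OF assms(3), of a] by blast
  have cont: "isCont \<phi> a" for a
    using loc[of a] superdifferentiable_on_isCont by blast
  have wS: "w k \<in> subdiff \<phi> (x k)" if "enat k \<le> N" for k
    using run that by blast
  \<comment> \<open>\<open>t\<close> is the accepted step size. Below \<open>\<tau>min\<close> it
    must have been reduced at least once, so \<open>t / \<beta>\<close> belongs to the last rejected
    trial point.\<close>
  have step: "\<exists>t. 0 < t \<and> t \<le> \<tau>max \<and> x (Suc k) \<in> proj_set D (x k - t *\<^sub>R w k) \<and>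
      \<phi> (x (Suc k)) \<le> R k + \<sigma> * (w k \<bullet> (x (Suc k) - x k)) \<and>
      (t < \<tau>min \<longrightarrow> (\<exists>y. y \<in> proj_set D (x k - (t / \<beta>) *\<^sub>R w k) \<and>
        \<phi> y > R k + \<sigma> * (w k \<bullet> (y - x k))))" if k: "enat k < N" for k
  proof -
    obtain m where m: "n k = enat m" "x (Suc k) = Y k m"
      and \<tau>k: "\<tau> k \<in> {\<tau>min..\<tau>max}"
      and loop: "backtracking_loop \<phi> D \<sigma> \<beta> (R k) (x k) (w k) (\<tau> k) (Y k) (n k)"
      using run k less_imp_le by metis
    have "\<beta> ^ m \<le> 1" using par by (intro power_le_one) auto
    then have t: "0 < \<beta> ^ m * \<tau> k" "\<beta> ^ m * \<tau> k \<le> \<tau>max"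
      using \<tau>k par mult_mono[of "\<beta> ^ m" 1 "\<tau> k" \<tau>max] by auto
    have acc: "Y k m \<in> proj_set D (x k - (\<beta> ^ m * \<tau> k) *\<^sub>R w k)"
        "\<phi> (Y k m) \<le> R k + \<sigma> * (w k \<bullet> (Y k m - x k))"
      using loop m(1) by (auto simp: backtracking_loop_def)
    have "\<exists>y. y \<in> proj_set D (x k - (\<beta> ^ m * \<tau> k / \<beta>) *\<^sub>R w k) \<and>
        \<phi> y > R k + \<sigma> * (w k \<bullet> (y - x k))" if "\<beta> ^ m * \<tau> k < \<tau>min"
    proof (cases m)
      case 0
      then show ?thesis using that \<tau>k by simp
    next
      case (Suc j)
      then have "\<beta> ^ m * \<tau> k / \<beta> = \<beta> ^ j * \<tau> k" using par by simp
      moreover have "enat j < n k" using m Suc by simp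
      ultimately show ?thesis using loop less_imp_le by (metis backtracking_loop_def)
    qed
    with t acc m show ?thesis by (intro exI[of _ "\<beta> ^ m * \<tau> k"]) auto
  qed
  have Rrec: "p (Suc k) \<in> {pmin..1}"
      "R (Suc k) = (1 - p (Suc k)) * R k + p (Suc k) * \<phi> (x (Suc k))" if "enat k < N" for k
    using run that by blast+
  \<comment> \<open>Both facts go through one induction: feasibility of \<open>x k\<close> makes the
    predicted change nonpositive, and this puts \<open>\<phi> (x (Suc k))\<close> below
    \<open>R k\<close>, hence below the convex combination \<open>R (Suc k)\<close>.\<close>
  have inv: "x k \<in> D \<and> \<phi> (x k) \<le> R k" if "enat k \<le> N" for k
    using that
  proof (induction k)
    case 0
    then show ?case using run by simp
  next
    case (Suc k)
    then have k: "enat k < N" by (simp add: Suc_ile_eq)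
    with Suc.IH have xk: "x k \<in> D" by simp
    obtain t where t: "0 < t" "x (Suc k) \<in> proj_set D (x k - t *\<^sub>R w k)"
      "\<phi> (x (Suc k)) \<le> R k + \<sigma> * (w k \<bullet> (x (Suc k) - x k))"
      using step[OF k] by blast
    have "\<sigma> * (w k \<bullet> (x (Suc k) - x k)) \<le> 0"
      using projection_step(2)[OF t(2) xk t(1)] par by (simp add: mult_nonneg_nonpos)
    then have "0 \<le> (1 - p (Suc k)) * (R k - \<phi> (x (Suc k)))"
      using t(3) Rrec(1)[OF k] by (intro mult_nonneg_nonneg) auto
    also have "\<dots> = R (Suc k) - \<phi> (x (Suc k))" by (simp add: Rrec(2)[OF k] algebra_simps)
    finally show ?case using t(2) by (simp add: proj_set_iff)
  qed
  show ?thesis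
  proof (cases N)
    case (enat k)
    \<comment> \<open>An endless loop would reject trial points with arbitrarily small steps
      \<open>\<beta> ^ i * \<tau> k\<close>, but those below \<open>s0\<close> are accepted.\<close>
    have "n k \<noteq> \<infinity>" if "\<not> stop k"
    proof
      assume inf: "n k = \<infinity>"
      have \<tau>k: "\<tau> k \<in> {\<tau>min..\<tau>max}"
        and loop: "backtracking_loop \<phi> D \<sigma> \<beta> (R k) (x k) (w k) (\<tau> k) (Y k) \<infinity>"
        using run enat that inf by (metis order_refl)+
      obtain \<delta> \<kappa> L where sd: "\<delta> > 0" "\<kappa> > 0" "superdifferentiable_on (ball (x k) \<delta>) \<kappa> L \<phi>"
        using loc by blast
      obtain s0 where s0: "s0 > 0" and acc: "\<And>z v s y R. z \<in> D \<Longrightarrow> z \<in> ball (x k) (\<delta> / 2) \<Longrightarrow>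
          supergradient_on (ball (x k) \<delta>) \<kappa> \<phi> z v \<Longrightarrow> 0 < s \<Longrightarrow> s \<le> s0 \<Longrightarrow>
          y \<in> proj_set D (z - s *\<^sub>R v) \<Longrightarrow> \<phi> z \<le> R \<Longrightarrow> \<phi> y \<le> R + \<sigma> * (v \<bullet> (y - z))"
        using small_steps_accepted[OF sd(3,1,2) \<open>\<sigma> < 1\<close>] by metis
      have \<tau>0: "\<tau> k > 0" using \<tau>k par by auto
      obtain i where "\<beta> ^ i < s0 / \<tau> k"
        using real_arch_pow_inv[of "s0 / \<tau> k" \<beta>] s0 \<tau>0 par by auto
      then have i: "\<beta> ^ i * \<tau> k \<le> s0" using \<tau>0 by (simp add: field_simps)
      have "supergradient_on (ball (x k) \<delta>) \<kappa> \<phi> (x k) (w k)"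
        using wS[of k] enat sd(1)
        by (intro subdifferential_supergradient_on[OF sub sd(3) _ _ cont]) auto
      then have "\<phi> (Y k i) \<le> R k + \<sigma> * (w k \<bullet> (Y k i - x k))"
        using inv[of k] enat sd(1) \<tau>0 par loop i
        by (intro acc[where s = "\<beta> ^ i * \<tau> k"]) (auto simp: backtracking_loop_def)
      then show False using loop by (auto simp: backtracking_loop_def not_less[symmetric])
    qed
    moreover have "\<forall>k. N = enat k \<longrightarrow> stop k \<or> n k = \<infinity>" using run by (elim conjE)
    then have "stop k \<or> n k = \<infinity>" using enat by simp
    ultimately have "stop k" by argo
    then show ?thesis using assms(14)[of k] enat by simp
  next
    case infinity
    then have lt: "enat k < N" "enat k \<le> N" for k by auto
    obtain t where t0: "\<And>k. 0 < t k" and tmax: "\<And>k. t k \<le> \<tau>max"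
      and xt: "\<And>k. x (Suc k) \<in> proj_set D (x k - t k *\<^sub>R w k)"
      and desc: "\<And>k. \<phi> (x (Suc k)) \<le> R k + \<sigma> * (w k \<bullet> (x (Suc k) - x k))"
      and rej: "\<And>k. t k < \<tau>min \<Longrightarrow> \<exists>y. y \<in> proj_set D (x k - (t k / \<beta>) *\<^sub>R w k) \<and>
        \<phi> y > R k + \<sigma> * (w k \<bullet> (y - x k))"
      using step[OF lt(1)] by metis
    note wS = wS[OF lt(2)] and inv = inv[OF lt(2)]
    have xD: "x k \<in> D" for k using inv by blast
    \<comment> \<open>The constant comes from \<open>projection_step\<close> with
      \<open>t k \<le> \<tau>max\<close>, inserted into the acceptance test.\<close>
    have suff: "\<phi> (x (Suc k)) \<le> R k - \<sigma> / (2 * \<tau>max) * (norm (x (Suc k) - x k))\<^sup>2" for k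
    proof -
      have "(norm (x (Suc k) - x k))\<^sup>2 \<le> 2 * t k * - (w k \<bullet> (x (Suc k) - x k))"
        using projection_step(1)[OF xt xD t0, of k] by simp
      also have "\<dots> \<le> 2 * \<tau>max * - (w k \<bullet> (x (Suc k) - x k))"
        using projection_step(2)[OF xt xD t0, of k] tmax[of k] by (intro mult_right_mono) auto
      finally have "\<sigma> / (2 * \<tau>max) * (norm (x (Suc k) - x k))\<^sup>2
          \<le> \<sigma> / (2 * \<tau>max) * (2 * \<tau>max * - (w k \<bullet> (x (Suc k) - x k)))"
        using par by (intro mult_left_mono) auto
      also have "\<dots> = - (\<sigma> * (w k \<bullet> (x (Suc k) - x k)))" using par by simp
      finally show ?thesis using desc[of k] by simp
    qed
    have c0: "0 < \<sigma> / (2 * \<tau>max)" using par by auto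
    have start: "\<phi> (x 0) = R 0" using run by simp
    have bdd: "bdd_below (range (\<lambda>k. \<phi> (x k)))" using assms(4) by (rule bdd_below_mono) auto
    obtain l where dec: "decseq R" and Rl: "R \<longlonglongrightarrow> l" and \<phi>l: "(\<lambda>k. \<phi> (x k)) \<longlonglongrightarrow> l"
      and d0: "(\<lambda>k. norm (x (Suc k) - x k)) \<longlonglongrightarrow> 0"
      using nonmonotone_descent_converges[where R = R and p = p and a = "\<lambda>k. \<phi> (x k)" and
          d = "\<lambda>k. norm (x (Suc k) - x k)", OF Rrec(2,1)[OF lt(1)] \<open>0 < pmin\<close> suff c0 start bdd]
      by blast
    have "(\<lambda>k. \<phi> (x k)) \<longlonglongrightarrow> \<phi> xs \<and> decseq R \<and> R \<longlonglongrightarrow> \<phi> xs \<and>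
        (\<exists>ws\<in>subdiff \<phi> xs. - ws \<in> proximal_normal_cone D xs)" if ap: "accumulation_point x xs" for xs
    proof -
      obtain r :: "nat \<Rightarrow> nat" where r: "strict_mono r" and xr: "(\<lambda>j. x (r j)) \<longlonglongrightarrow> xs"
        using ap by (auto simp: accumulation_point_def o_def)
      have "(\<lambda>j. \<phi> (x (r j))) \<longlonglongrightarrow> l" using LIMSEQ_subseq_LIMSEQ[OF \<phi>l r] by (simp add: o_def)
      then have l: "l = \<phi> xs" using LIMSEQ_unique isCont_tendsto_compose[OF cont xr] by blast
      obtain \<delta> \<kappa> L where sd: "\<delta> > 0" "\<kappa> > 0" "superdifferentiable_on (ball xs \<delta>) \<kappa> L \<phi>"
        using loc by blast
      obtain s0 where s0: "s0 > 0" and acc: "\<And>z v s y R. z \<in> D \<Longrightarrow> z \<in> ball xs (\<delta> / 2) \<Longrightarrow>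
          supergradient_on (ball xs \<delta>) \<kappa> \<phi> z v \<Longrightarrow> 0 < s \<Longrightarrow> s \<le> s0 \<Longrightarrow>
          y \<in> proj_set D (z - s *\<^sub>R v) \<Longrightarrow> \<phi> z \<le> R \<Longrightarrow> \<phi> y \<le> R + \<sigma> * (v \<bullet> (y - z))"
        using small_steps_accepted[OF sd(3,1,2) \<open>\<sigma> < 1\<close>] by metis
      \<comment> \<open>A compact set that holds subgradient and step size whenever the iterate is
        within \<open>\<delta> / 2\<close> of \<open>xs\<close>. The lower end is positive: a step
        below \<open>\<tau>min\<close> has a rejected predecessor \<open>t k / \<beta>\<close>,
        which therefore exceeds \<open>s0\<close>.\<close>
      define K where "K = cball (0::'a) (\<bar>L\<bar> + \<bar>\<kappa>\<bar> * \<delta>) \<times> {min \<tau>min (\<beta> * s0)..\<tau>max}"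
      have K: "(w k, t k) \<in> K" if k: "x k \<in> ball xs (\<delta> / 2)" for k
      proof -
        have sg: "supergradient_on (ball xs \<delta>) \<kappa> \<phi> (x k) (w k)"
          using wS k sd(1) by (intro subdifferential_supergradient_on[OF sub sd(3) _ _ cont]) auto
        have "\<beta> * s0 \<le> t k" if "t k < \<tau>min"
        proof (rule ccontr)
          assume "\<not> \<beta> * s0 \<le> t k"
          then have "t k / \<beta> \<le> s0" "0 < t k / \<beta>" using par t0[of k] by (auto simp: field_simps)
          with acc[OF xD k sg] rej[OF that] inv[of k] show False by (meson not_less)
        qed
        then show ?thesis
          using superdifferentiable_on_supergradient_bounded[OF sd(3,1) k sg] tmax[of k]
          by (auto simp: K_def min_le_iff_disj not_less[symmetric])
      qed
      have "\<forall>\<^sub>F j in sequentially. x (r j) \<in> ball xs (\<delta> / 2)"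
        using sd(1) by (intro topological_tendstoD[OF xr]) auto
      then obtain J where J: "\<And>j. j \<ge> J \<Longrightarrow> x (r j) \<in> ball xs (\<delta> / 2)"
        by (auto simp: eventually_sequentially)
      have cK: "compact K" unfolding K_def by (intro compact_Times) auto
      have "\<forall>j. (w (r (j + J)), t (r (j + J))) \<in> K" using J K by simp
      then obtain lim q where lim: "lim \<in> K" and q: "strict_mono (q :: nat \<Rightarrow> nat)"
        and conv: "((\<lambda>j. (w (r (j + J)), t (r (j + J)))) \<circ> q) \<longlonglongrightarrow> lim"
        using spec[OF iffD1[OF compact_def cK], of "\<lambda>j. (w (r (j + J)), t (r (j + J)))"] by blast
      obtain ws ts where lim_eq: "lim = (ws, ts)" by fastforce
      \<comment> \<open>Three selections combined: \<open>r\<close> leads to \<open>xs\<close>, the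
        shift by \<open>J\<close> enters the ball, and \<open>q\<close> makes subgradients and step
        sizes converge together.\<close>
      define i where "i j = r (q j + J)" for j
      have wi: "(\<lambda>j. w (i j)) \<longlonglongrightarrow> ws" and ti: "(\<lambda>j. t (i j)) \<longlonglongrightarrow> ts"
        using tendsto_fst[OF conv] tendsto_snd[OF conv] by (simp_all add: lim_eq i_def o_def)
      have ts: "ts > 0" using lim par s0 by (auto simp: K_def lim_eq min_le_iff_disj intro: less_le_trans mult_pos_pos)
      have i: "strict_mono i"
        using r q by (auto simp: i_def strict_mono_def)
      have xi: "(\<lambda>j. x (i j)) \<longlonglongrightarrow> xs"
        using LIMSEQ_subseq_LIMSEQ[OF LIMSEQ_ignore_initial_segment[OF xr, of J] q]
        by (simp add: i_def o_def)
      have "(\<lambda>j. norm (x (Suc (i j)) - x (i j))) \<longlonglongrightarrow> 0"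
        using LIMSEQ_subseq_LIMSEQ[OF d0 i] by (simp add: o_def)
      \<comment> \<open>Since consecutive iterates merge, the projected points
        \<open>x (Suc (i j))\<close> share the limit \<open>xs\<close> of their base points, as the
        limit lemma for the cone requires.\<close>
      then have "(\<lambda>j. x (Suc (i j)) - x (i j)) \<longlonglongrightarrow> 0" by (rule tendsto_norm_zero_cancel)
      from tendsto_add[OF this xi] have xSi: "(\<lambda>j. x (Suc (i j))) \<longlonglongrightarrow> xs" by simp
      have "- ws \<in> proximal_normal_cone D xs"
        by (rule proximal_normal_cone_limit[OF D xt xi xSi wi ti ts])
      moreover have "ws \<in> subdiff \<phi> xs"
        using sd(1) by (intro subdifferential_closed_graph[OF sub sd(3) _ _ cont xi wi wS]) auto
      ultimately show ?thesis using \<phi>l Rl dec l by blast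
    qed
    then show ?thesis using infinity by blast
  qed
qed

end
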